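(* Let $a,b,k$ be positive integers with $b>\frac{2a}{k}$. Then, for all sufficiently large $n$, PhantomBreaker has a randomized strategy to win the $(a:b)$ mindegree-$k$ Maker-PhantomBreaker game on $E(K_n)$ against Maker with probability at least a positive constant depending only on $a$ and $b$. That is, there is a constant $c=c(a,b)>0$, depending only on $a$ and $b$ (not on $k$ or $n$), such that for all sufficiently large $n$ PhantomBreaker has a randomized strategy which, against every (possibly randomized) strategy of Maker, wins for PhantomBreaker with probability at least $c$.
   Context: Maker-PhantomBreaker game. The board is the edge set $E(K_n)$ of the complete graph on $n$ vertices, and there is a family of winning sets (edge sets of certain subgraphs of $K_n$). Initially all edges are unclaimed. Two players, Maker and PhantomBreaker, alternate turns, Maker going first. In an $(a:b)$ game, in each round Maker first makes $a$ moves, one after another, each consisting of attempting to claim one edge of $K_n$; then PhantomBreaker claims $b$ unclaimed edges (all remaining unclaimed edges if fewer than $b$ remain). If the edge Maker attempts to claim is unclaimed, it becomes hers. If it has already been claimed by PhantomBreaker, then that move of Maker is lost (she gets no replacement move) and she learns that this edge belongs to PhantomBreaker. Information: PhantomBreaker has complete information about the game so far (he sees all previous moves of Maker, including failed attempts, but not the outcomes of Maker's future random choices). Maker sees none of PhantomBreaker's moves; her only information about them is the success or failure of her own previous attempts. Maker wins if at some point she has claimed all edges of some winning set; otherwise PhantomBreaker wins. Both players may use randomized strategies, where each decision of PhantomBreaker may depend only on all previous moves of both players (including Maker's failed attempts) and his own randomness, and each decision of Maker may depend only on her own previous attempts, their success or failure, and her own randomness. Mindegree-$k$ game: the winning sets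 are the edge sets of all spanning subgraphs of $K_n$ with minimum degree $k$ (equivalently, Maker wins iff every vertex eventually has degree at least $k$ in the graph of Maker's claimed edges). *)

theory Defs
  imports "HOL-Probability.Probability"
begin

text \<open>
  A history is the chronological list of all moves. \<open>Attempt e s\<close> is a single move of Maker, where
  \<open>s\<close> tells whether \<open>e\<close> is Maker's after the attempt. It is \<open>False\<close> exactly when \<open>e\<close>
  belongs to PhantomBreaker already. \<open>Claim C\<close> is a full turn of PhantomBreaker.
\<close>

datatype 'e move = Attempt 'e bool | Claim "'e set"

type_synonym 'e history = "'e move list"

definition maker_edges :: "'e history \<Rightarrow> 'e set" where
  "maker_edges h = {e. Attempt e True \<in> set h}"

definition breaker_edges :: "'e history \<Rightarrow> 'e set" where
  "breaker_edges h = \<Union> {C. Claim C \<in> set h}"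

definition unclaimed :: "'e set \<Rightarrow> 'e history \<Rightarrow> 'e set" where
  "unclaimed X h = X - maker_edges h - breaker_edges h"

fun is_attempt :: "'e move \<Rightarrow> bool" where
  "is_attempt (Attempt e s) = True"
| "is_attempt (Claim C) = False"

definition maker_view :: "'e history \<Rightarrow> 'e history" where
  "maker_view h = filter is_attempt h"

type_synonym 'e maker = "'e history \<Rightarrow> 'e"
type_synonym 'e breaker = "'e history \<Rightarrow> 'e set"

text \<open>
  Maker may attempt any element of the board \<open>X\<close>. Attempting one that is already hers changes
  nothing. PhantomBreaker's strategy is also constrained on histories that never arise in play; as
  a legal answer always exists, this excludes no way of playing.
\<close>

definition maker_strategy :: "'e set \<Rightarrow> 'e maker \<Rightarrow> bool" where
  "maker_strategy X \<sigma> \<longleftrightarrow> (\<forall>h. \<sigma> h \<in> X)"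

definition breaker_strategy :: "'e set \<Rightarrow> nat \<Rightarrow> 'e breaker \<Rightarrow> bool" where
  "breaker_strategy X b \<tau> \<longleftrightarrow>
     (\<forall>h. \<tau> h \<subseteq> unclaimed X h \<and> card (\<tau> h) = min b (card (unclaimed X h)))"

definition maker_move :: "'e maker \<Rightarrow> 'e history \<Rightarrow> 'e history" where
  "maker_move \<sigma> h = (let e = \<sigma> (maker_view h) in h @ [Attempt e (e \<notin> breaker_edges h)])"

definition breaker_turn :: "'e breaker \<Rightarrow> 'e history \<Rightarrow> 'e history" where
  "breaker_turn \<tau> h = h @ [Claim (\<tau> h)]"

definition play_round :: "nat \<Rightarrow> 'e maker \<Rightarrow> 'e breaker \<Rightarrow> 'e history \<Rightarrow> 'e history" where
  "play_round a \<sigma> \<tau> h = breaker_turn \<tau> ((maker_move \<sigma> ^^ a) h)"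

definition play :: "nat \<Rightarrow> 'e maker \<Rightarrow> 'e breaker \<Rightarrow> nat \<Rightarrow> 'e history" where
  "play a \<sigma> \<tau> t = (play_round a \<sigma> \<tau> ^^ t) []"

text \<open>
  Play is formally continued forever, but once the board is exhausted nothing changes any more.
  As \<open>maker_edges\<close> only grows, it suffices to inspect it at the ends of rounds.
\<close>

definition maker_wins :: "'e set set \<Rightarrow> nat \<Rightarrow> 'e maker \<Rightarrow> 'e breaker \<Rightarrow> bool" where
  "maker_wins W a \<sigma> \<tau> \<longleftrightarrow> (\<exists>t. \<exists>F\<in>W. F \<subseteq> maker_edges (play a \<sigma> \<tau> t))"

text \<open>
  A randomized strategy is a probability distribution on deterministic strategies. On a finite
  board only finitely many deterministic strategies differ on the histories that matter, so
  discrete distributions are fully general. The two players randomize independently.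
\<close>

definition randomized_maker :: "'e set \<Rightarrow> 'e maker pmf \<Rightarrow> bool" where
  "randomized_maker X M \<longleftrightarrow> (\<forall>\<sigma>\<in>set_pmf M. maker_strategy X \<sigma>)"

definition randomized_breaker :: "'e set \<Rightarrow> nat \<Rightarrow> 'e breaker pmf \<Rightarrow> bool" where
  "randomized_breaker X b B \<longleftrightarrow> (\<forall>\<tau>\<in>set_pmf B. breaker_strategy X b \<tau>)"

definition breaker_win_prob :: "'e set set \<Rightarrow> nat \<Rightarrow> 'e maker pmf \<Rightarrow> 'e breaker pmf \<Rightarrow> real" where
  "breaker_win_prob W a M B = measure_pmf.prob (pair_pmf M B) {(\<sigma>, \<tau>). \<not> maker_wins W a \<sigma> \<tau>}"

definition complete_edges :: "nat \<Rightarrow> nat set set" where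
  "complete_edges n = {e. e \<subseteq> {..<n} \<and> card e = 2}"

definition vertex_degree :: "nat set set \<Rightarrow> nat \<Rightarrow> nat" where
  "vertex_degree F v = card {e \<in> F. v \<in> e}"

definition min_degree :: "nat \<Rightarrow> nat set set \<Rightarrow> nat" where
  "min_degree n F = Min (vertex_degree F ` {..<n})"

definition mindegree_sets :: "nat \<Rightarrow> nat \<Rightarrow> nat set set set" where
  "mindegree_sets n k = {F. F \<subseteq> complete_edges n \<and> min_degree n F = k}"

text \<open>
  Requiring minimum degree exactly \<open>k\<close> in the winning sets is the same as letting Maker win
  once all degrees in her graph are at least \<open>k\<close>.
\<close>

lemma finite_complete_edges: "finite (complete_edges n)"
  unfolding complete_edges_def by (rule finite_subset[of _ "Pow {..<n}"]) auto

lemma contains_mindegree_set_iff: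
  assumes "n > 0" "F \<subseteq> complete_edges n"
  shows "(\<exists>G\<in>mindegree_sets n k. G \<subseteq> F) \<longleftrightarrow> (\<forall>v<n. k \<le> vertex_degree F v)"
proof
  have fin: "finite F" using assms(2) finite_complete_edges finite_subset by blast
  assume "\<exists>G\<in>mindegree_sets n k. G \<subseteq> F"
  then obtain G where G: "G \<subseteq> F" "min_degree n G = k" by (auto simp: mindegree_sets_def)
  show "\<forall>v<n. k \<le> vertex_degree F v"
  proof (intro allI impI)
    fix v assume "v < n"
    then have "k \<le> vertex_degree G v" using G(2) unfolding min_degree_def by auto
    also have "\<dots> \<le> vertex_degree F v"
      unfolding vertex_degree_def using G(1) fin by (intro card_mono) auto
    finally show "k \<le> vertex_degree F v" .
  qed
next
  have "finite F" using assms(2) finite_complete_edges finite_subset by blast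
  then show "\<forall>v<n. k \<le> vertex_degree F v \<Longrightarrow> \<exists>G\<in>mindegree_sets n k. G \<subseteq> F" using assms(2)
  proof (induction F rule: finite_psubset_induct)
    case (psubset F)
    have ne: "vertex_degree F ` {..<n} \<noteq> {}" "finite (vertex_degree F ` {..<n})" using assms(1) by auto
    have ge: "k \<le> min_degree n F" using psubset.prems(1) ne unfolding min_degree_def by auto
    show ?case
    proof (cases "min_degree n F = k")
      case True
      then show ?thesis using psubset.prems unfolding mindegree_sets_def by auto
    next
      case False
      then have gt: "k < vertex_degree F v" if "v < n" for v
      proof -
        have "min_degree n F \<le> vertex_degree F v"
          unfolding min_degree_def using that by (intro Min_le) auto
        then show ?thesis using ge False by linarith
      qed
      then have "F \<noteq> {}" using assms(1) unfolding vertex_degree_def by fastforce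
      then obtain e where e: "e \<in> F" by auto
      have "k \<le> vertex_degree (F - {e}) v" if "v < n" for v
      proof -
        have "{f \<in> F - {e}. v \<in> f} = {f \<in> F. v \<in> f} - {e}" by auto
        then have "vertex_degree F v \<le> Suc (vertex_degree (F - {e}) v)"
          unfolding vertex_degree_def using psubset.hyps by (simp add: card_Diff_singleton_if) linarith
        then show ?thesis using gt[OF that] by simp
      qed
      then have "\<exists>G\<in>mindegree_sets n k. G \<subseteq> F - {e}"
        using psubset.IH[of "F - {e}"] e psubset.prems(2) by auto
      then show ?thesis by auto
    qed
  qed
qed

end

theory Submission imports Defs begin

text \<open>
  PhantomBreaker secretly picks a random vertex \<open>v\<close> and claims nothing but edges of its star. He
  owns the whole star, up to the edges that Maker has taken, after about \<open>n / b\<close> rounds. By then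
  Maker has made about \<open>a n / b\<close> attempts, which contribute \<open>2 a n / b < k n\<close> to the degrees, so
  a positive fraction of all vertices have been tried fewer than \<open>k\<close> times. If \<open>v\<close> is one of them
  and Maker never runs into a claimed edge, her degree at \<open>v\<close> stays below \<open>k\<close> for ever.

  The danger is a failed attempt, since it tells Maker where \<open>v\<close> is. As long as she meets no
  failure, a deterministic Maker follows one fixed sequence of attempts (\<open>ideal_attempt\<close>),
  whatever PhantomBreaker does; so it suffices that he avoids every edge of this sequence until she
  has tried it. He guesses: colour the edges at \<open>v\<close> with \<open>q\<close> colours according to their other
  endpoint, draw a random set \<open>J\<close> of colours, and keep the edges with colours in \<open>J\<close> in reserve,
  to be claimed only when the rest of the star is gone. With probability \<open>2 powr (-q)\<close> the set
  \<open>J\<close> consists exactly of the colours that Maker is going to try at \<open>v\<close>. These are fewer than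
  \<open>k\<close>, so for large \<open>q\<close> the reserve is a small part of the star and PhantomBreaker needs it only
  in a short final phase. Hence he goes unnoticed if Maker does not try \<open>v\<close> during that phase. A
  short phase touches few vertices, and because of \<open>2 a < b k\<close> a fraction of order
  \<open>1 / (b k)\<close> of the vertices still satisfies both requirements (\<open>card_good_vertices\<close>).

  Winning with a smaller \<open>k\<close> is harder for PhantomBreaker, and \<open>2 a < b k\<close> holds for
  \<open>k = 2 a + 1\<close> already. So \<open>k\<close> may be replaced by its minimum with \<open>2 a + 1\<close>, which makes \<open>q\<close>
  and the winning probability depend on \<open>a\<close> and \<open>b\<close> only. The bound holds against each
  deterministic Maker, hence on average over a randomized one (\<open>breaker_win_prob_ge\<close>).
\<close>

section \<open>Edges claimed along a history\<close>

lemma maker_edges_append: "maker_edges (h @ h') = maker_edges h \<union> maker_edges h'"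
  by (auto simp: maker_edges_def)

lemma breaker_edges_append: "breaker_edges (h @ h') = breaker_edges h \<union> breaker_edges h'"
  by (auto simp: breaker_edges_def)

lemma maker_edges_Attempt: "maker_edges [Attempt e s] = (if s then {e} else {})"
  by (auto simp: maker_edges_def)

lemma maker_edges_Claim: "maker_edges [Claim C] = {}"
  by (auto simp: maker_edges_def)

lemma breaker_edges_Attempt: "breaker_edges [Attempt e s] = {}"
  by (auto simp: breaker_edges_def)

lemma breaker_edges_Claim: "breaker_edges [Claim C] = C"
  by (auto simp: breaker_edges_def)

lemmas edges_append_simps = maker_edges_append breaker_edges_append maker_edges_Attempt
  maker_edges_Claim breaker_edges_Attempt breaker_edges_Claim

lemma maker_edges_maker_view: "maker_edges (maker_view h) = maker_edges h"
  by (auto simp: maker_edges_def maker_view_def)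

lemma breaker_edges_maker_moves: "breaker_edges ((maker_move \<sigma> ^^ j) h) = breaker_edges h"
  by (induction j) (auto simp: maker_move_def Let_def edges_append_simps)

lemma maker_edges_maker_moves:
  "maker_edges ((maker_move \<sigma> ^^ j) h) \<subseteq> maker_edges h \<union> - breaker_edges h"
proof (induction j)
  case (Suc j)
  have "maker_edges (maker_move \<sigma> g) \<subseteq> maker_edges g \<union> - breaker_edges g" for g
    by (auto simp: maker_move_def Let_def edges_append_simps)
  from this[of "(maker_move \<sigma> ^^ j) h"] show ?case
    using Suc.IH by (auto simp: breaker_edges_maker_moves)
qed simp

section \<open>Maker's play without failures\<close>

text \<open>What Maker sees after \<open>m\<close> moves if none of her attempts has failed.\<close>

fun ideal_view :: "'e maker \<Rightarrow> nat \<Rightarrow> 'e history" where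
  "ideal_view \<sigma> 0 = []"
| "ideal_view \<sigma> (Suc m) = ideal_view \<sigma> m @ [Attempt (\<sigma> (ideal_view \<sigma> m)) True]"

definition ideal_attempt :: "'e maker \<Rightarrow> nat \<Rightarrow> 'e" where
  "ideal_attempt \<sigma> i = \<sigma> (ideal_view \<sigma> i)"

lemma maker_edges_ideal_view: "maker_edges (ideal_view \<sigma> m) = ideal_attempt \<sigma> ` {..<m}"
  by (induction m) (auto simp: edges_append_simps ideal_attempt_def lessThan_Suc maker_edges_def)

lemma maker_view_maker_move:
  "maker_view (maker_move \<sigma> h) =
     maker_view h @ [Attempt (\<sigma> (maker_view h)) (\<sigma> (maker_view h) \<notin> breaker_edges h)]"
  by (simp add: maker_move_def Let_def maker_view_def)

text \<open>
  Maker's decisions depend on her view alone, so a PhantomBreaker who owns none of the next ideal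
  attempts cannot make her leave the ideal sequence.
\<close>

lemma maker_view_maker_moves_ideal:
  assumes "maker_view h = ideal_view \<sigma> m"
    and "\<And>i. m \<le> i \<Longrightarrow> i < m + j \<Longrightarrow> ideal_attempt \<sigma> i \<notin> breaker_edges h"
  shows "maker_view ((maker_move \<sigma> ^^ j) h) = ideal_view \<sigma> (m + j)"
  using assms(2)
proof (induction j)
  case 0
  then show ?case using assms(1) by simp
next
  case (Suc j)
  then have "maker_view ((maker_move \<sigma> ^^ j) h) = ideal_view \<sigma> (m + j)" by simp
  moreover have "ideal_attempt \<sigma> (m + j) \<notin> breaker_edges ((maker_move \<sigma> ^^ j) h)"
    using Suc.prems by (simp add: breaker_edges_maker_moves)
  ultimately show ?case
    by (simp add: maker_view_maker_move ideal_attempt_def)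
qed

section \<open>Claiming edges by priority\<close>

lemma ex_prioritized_subset:
  assumes "finite U" "P \<subseteq> Q" "Q \<subseteq> U"
  shows "\<exists>C\<subseteq>U. card C = min b (card U) \<and> (C \<subseteq> P \<or> P \<subseteq> C) \<and> (C \<subseteq> Q \<or> Q \<subseteq> C)"
proof -
  have fin: "finite Q" "finite P"
    using assms by (auto intro: rev_finite_subset dest: subset_trans)
  consider "b \<le> card P" | "card P \<le> b" "b \<le> card Q" | "card Q \<le> b" by linarith
  then show ?thesis
  proof cases
    case 1
    then obtain C where "C \<subseteq> P" "card C = b" by (meson obtain_subset_with_card_n)
    then show ?thesis using assms card_mono[OF assms(1), of C]
      by (intro exI[of _ C]) auto
  next
    case 2
    then obtain C where "P \<subseteq> C" "C \<subseteq> Q" "card C = b"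
      using exists_subset_between[of P b Q] assms(2) fin by auto
    then show ?thesis using assms card_mono[OF assms(1), of C]
      by (intro exI[of _ C]) auto
  next
    case 3
    have "card Q \<le> card U" using assms card_mono by blast
    with 3 obtain C where "Q \<subseteq> C" "C \<subseteq> U" "card C = min b (card U)"
      using exists_subset_between[of Q "min b (card U)" U] assms by auto
    then show ?thesis using assms by (intro exI[of _ C]) auto
  qed
qed

text \<open>
  Claims outside \<open>P\<close> are made only in a turn that takes everything left in \<open>P\<close>.
\<close>

definition prioritizing :: "'e set \<Rightarrow> 'e set \<Rightarrow> 'e breaker \<Rightarrow> bool" where
  "prioritizing X P \<tau> \<longleftrightarrow>
     (\<forall>h. \<tau> h \<subseteq> unclaimed X h \<inter> P \<or> unclaimed X h \<inter> P \<subseteq> \<tau> h)"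

lemma ex_prioritizing_breaker:
  assumes "finite X" "P \<subseteq> Q"
  shows "\<exists>\<tau>. breaker_strategy X b \<tau> \<and> prioritizing X P \<tau> \<and> prioritizing X Q \<tau>"
proof -
  have "\<exists>C\<subseteq>unclaimed X h. card C = min b (card (unclaimed X h)) \<and>
          (C \<subseteq> unclaimed X h \<inter> P \<or> unclaimed X h \<inter> P \<subseteq> C) \<and>
          (C \<subseteq> unclaimed X h \<inter> Q \<or> unclaimed X h \<inter> Q \<subseteq> C)" for h
    by (rule ex_prioritized_subset) (use assms in \<open>auto simp: unclaimed_def\<close>)
  then show ?thesis unfolding breaker_strategy_def prioritizing_def by metis
qed

section \<open>Claiming a hidden set\<close>

text \<open>
  The mechanism works for any set \<open>S\<close> of board elements in place of a star. Here \<open>R\<close> is the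
  reserve, \<open>T\<close> a number of rounds in which all of \<open>S\<close> can be claimed, and \<open>T'\<close> a number of rounds
  during which the part of \<open>S\<close> outside the reserve lasts. The assumption on the attempts is
  what a lucky guess of \<open>S\<close> and \<open>R\<close> achieves against \<open>\<sigma>\<close>.
\<close>

locale hidden_target =
  fixes X S R :: "'e set" and a b T T' :: nat and \<sigma> :: "'e maker" and \<tau> :: "'e breaker"
  assumes finite_board: "finite X"
    and target: "R \<subseteq> S" "S \<subseteq> X"
    and breaker: "breaker_strategy X b \<tau>"
    and priority: "prioritizing X (S - R) \<tau>" "prioritizing X S \<tau>"
    and attempts: "\<And>i. i < a * T \<Longrightarrow> ideal_attempt \<sigma> i \<in> S \<Longrightarrow>
                     i < a * T' \<and> ideal_attempt \<sigma> i \<in> R"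
    and stock: "b * T' \<le> card (S - R)"
    and exhaust: "card S < b * T"
begin

definition ideal_gains :: "'e set" where
  "ideal_gains = ideal_attempt \<sigma> ` {..<a * T} \<inter> S"

text \<open>
  The cardinality records that no claim has been wasted outside \<open>S\<close>, which is what makes \<open>T\<close>
  rounds enough.
\<close>

definition undetected :: "nat \<Rightarrow> 'e history \<Rightarrow> bool" where
  "undetected t h \<longleftrightarrow> maker_view h = ideal_view \<sigma> (a * t) \<and> breaker_edges h \<subseteq> S \<and>
     card (breaker_edges h) = b * t \<and> (t \<le> T' \<longrightarrow> breaker_edges h \<inter> R = {})"

text \<open>
  The first inclusion freezes the situation: all that Maker could still take in \<open>S\<close> is
  something that she may have. From here on it is harmless if her attempts start to fail.
\<close>

definition settled :: "'e history \<Rightarrow> bool" where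
  "settled h \<longleftrightarrow> S - breaker_edges h \<subseteq> ideal_gains \<and> maker_edges h \<inter> S \<subseteq> ideal_gains"

lemma settled_play_round: "settled h \<Longrightarrow> settled (play_round a \<sigma> \<tau> h)"
  using maker_edges_maker_moves[of a \<sigma> h]
  unfolding settled_def play_round_def breaker_turn_def
  by (auto simp: edges_append_simps breaker_edges_maker_moves)

text \<open>
  No attempt of this round fails. One that hit a claimed element of \<open>S\<close> would be made within the
  first \<open>T'\<close> rounds and aim at the reserve, of which nothing is claimed yet. PhantomBreaker then
  either takes the last free elements of \<open>S\<close>, which settles the game, or finds \<open>b\<close> of them; up to
  round \<open>T'\<close> he finds them outside the reserve, because Maker has taken nothing there and it
  has at least \<open>b * T'\<close> elements.
\<close>

lemma undetected_play_round:
  assumes und: "undetected t h" and t: "t < T"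
  shows "undetected (Suc t) (play_round a \<sigma> \<tau> h) \<or> settled (play_round a \<sigma> \<tau> h)"
proof -
  define h' where "h' = (maker_move \<sigma> ^^ a) h"
  define C where "C = \<tau> h'"
  define U where "U = unclaimed X h'"
  have view: "maker_view h = ideal_view \<sigma> (a * t)" and brS: "breaker_edges h \<subseteq> S"
    and brcard: "card (breaker_edges h) = b * t"
    and brR: "t \<le> T' \<Longrightarrow> breaker_edges h \<inter> R = {}"
    using und by (auto simp: undetected_def)
  have aT: "a * Suc t \<le> a * T" using t by (intro mult_le_mono) auto
  have fin: "finite S" "finite U" "finite (breaker_edges h)"
    using finite_board target brS by (auto simp: U_def unclaimed_def intro: rev_finite_subset)
  have br': "breaker_edges h' = breaker_edges h"
    by (simp add: h'_def breaker_edges_maker_moves)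
  have view': "maker_view h' = ideal_view \<sigma> (a * Suc t)"
  proof -
    have "ideal_attempt \<sigma> i \<notin> breaker_edges h" if i: "a * t \<le> i" "i < a * t + a" for i
    proof
      assume claimed: "ideal_attempt \<sigma> i \<in> breaker_edges h"
      have "i < a * T" using i(2) aT by simp
      then have "i < a * T'" "ideal_attempt \<sigma> i \<in> R" using attempts claimed brS by blast+
      moreover from this(1) i(1) have "a * t < a * T'" by linarith
      then have "t \<le> T'" by simp
      ultimately show False using brR claimed by blast
    qed
    then show ?thesis
      using maker_view_maker_moves_ideal[OF view, of a] by (simp add: h'_def add.commute)
  qed
  have maker': "maker_edges h' = ideal_attempt \<sigma> ` {..<a * Suc t}"
    using maker_edges_maker_view[of h'] view' maker_edges_ideal_view by metis
  have makerT: "maker_edges h' \<subseteq> ideal_attempt \<sigma> ` {..<a * T}"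
    unfolding maker' using aT by (intro image_mono) auto
  then have ideal_gains: "maker_edges h' \<inter> S \<subseteq> ideal_gains" by (auto simp: ideal_gains_def)
  have makerR: "maker_edges h' \<inter> S \<subseteq> R" using makerT attempts by blast
  have C: "C \<subseteq> U" "card C = min b (card U)"
    using breaker by (simp_all add: breaker_strategy_def C_def U_def)
  have result: "play_round a \<sigma> \<tau> h = h' @ [Claim C]"
    by (simp add: play_round_def breaker_turn_def C_def h'_def)
  show ?thesis
  proof (cases "U \<inter> S \<subseteq> C")
    case True
    have "S \<subseteq> X" by (rule target)
    then have "S - (breaker_edges h' \<union> C) \<subseteq> maker_edges h'"
      using True by (auto simp: U_def unclaimed_def)
    then have "settled (h' @ [Claim C])"
      using ideal_gains by (auto simp: settled_def edges_append_simps)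
    then show ?thesis by (simp add: result)
  next
    case False
    then have CS: "C \<subseteq> S" using priority(2) by (auto simp: prioritizing_def C_def U_def)
    have Cb: "card C = b"
    proof -
      have "C \<subset> U" using C(1) False by blast
      then have "card C < card U" using fin(2) by (rule psubset_card_mono[rotated])
      then show ?thesis using C(2) by simp
    qed
    have disj: "breaker_edges h \<inter> C = {}"
      using C(1) br' by (auto simp: U_def unclaimed_def)
    have finC: "finite C" using C(1) fin(2) finite_subset by blast
    have "C \<inter> R = {}" if t': "Suc t \<le> T'"
    proof -
      have "C \<subseteq> U \<inter> (S - R)"
      proof (cases "C \<subseteq> U \<inter> (S - R)")
        case False
        then have "U \<inter> (S - R) \<subseteq> C"
          using priority(1) by (auto simp: prioritizing_def C_def U_def)
        moreover have "card C \<le> card (U \<inter> (S - R))"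
        proof -
          have "U \<inter> (S - R) = (S - R) - breaker_edges h"
            using makerR target br' by (auto simp: U_def unclaimed_def)
          moreover have "card (S - R) - b * t \<le> card ((S - R) - breaker_edges h)"
            using diff_card_le_card_Diff[OF fin(3)] brcard by simp
          moreover have "b * Suc t \<le> card (S - R)"
            using mult_le_mono2[OF t', of b] stock by simp
          ultimately show ?thesis using Cb by simp
        qed
        ultimately show ?thesis using finC card_seteq by blast
      qed
      then show ?thesis by blast
    qed
    then have "undetected (Suc t) (h' @ [Claim C])"
      unfolding undetected_def
      using view' brS CS brR br' disj Cb brcard finC fin(3)
      by (auto simp: edges_append_simps card_Un_disjoint maker_view_def)
    then show ?thesis by (simp add: result)
  qed
qed

text \<open>
  PhantomBreaker cannot be undetected after \<open>T\<close> rounds, as he would own more than all of \<open>S\<close>.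
\<close>

lemma play_undetected_or_settled:
  "(t < T \<and> undetected t (play a \<sigma> \<tau> t)) \<or> settled (play a \<sigma> \<tau> t)"
proof (induction t)
  case 0
  have "0 < T" using exhaust by (cases T) auto
  then show ?case
    by (simp add: undetected_def play_def maker_view_def breaker_edges_def)
next
  case (Suc t)
  have step: "play a \<sigma> \<tau> (Suc t) = play_round a \<sigma> \<tau> (play a \<sigma> \<tau> t)"
    by (simp add: play_def)
  have "Suc t < T" if "undetected (Suc t) h" "t < T" for h
  proof (rule ccontr)
    assume "\<not> Suc t < T"
    then have "Suc t = T" using that(2) by simp
    then have "card (breaker_edges h) = b * T" "breaker_edges h \<subseteq> S"
      using that(1) by (auto simp: undetected_def)
    moreover have "finite S" using finite_board target(2) by (rule rev_finite_subset)
    ultimately show False using exhaust card_mono[of S "breaker_edges h"] by simp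
  qed
  then show ?case
    using Suc.IH undetected_play_round settled_play_round unfolding step by blast
qed

lemma maker_edges_play_subset:
  "maker_edges (play a \<sigma> \<tau> t) \<inter> S \<subseteq> ideal_attempt \<sigma> ` {i. i < a * T \<and> ideal_attempt \<sigma> i \<in> S}"
  using play_undetected_or_settled[of t]
proof
  assume "t < T \<and> undetected t (play a \<sigma> \<tau> t)"
  then have "maker_edges (play a \<sigma> \<tau> t) = ideal_attempt \<sigma> ` {..<a * t}" "a * t \<le> a * T"
    using maker_edges_maker_view maker_edges_ideal_view unfolding undetected_def by (metis, simp)
  then have "maker_edges (play a \<sigma> \<tau> t) \<subseteq> ideal_attempt \<sigma> ` {..<a * T}"
    by (metis image_mono lessThan_subset_iff)
  then show ?thesis by blast
qed (auto simp: settled_def ideal_gains_def)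

end

section \<open>Vertices that Maker neglects\<close>

lemma card_complete_edge: "e \<in> complete_edges n \<Longrightarrow> card e = 2"
  by (simp add: complete_edges_def)

lemma finite_complete_edge: "e \<in> complete_edges n \<Longrightarrow> finite e"
  by (auto simp: complete_edges_def intro: finite_subset)

lemma sum_card_attempts_at:
  assumes "\<And>i. e i \<in> complete_edges n"
  shows "(\<Sum>v<n. card {i. i < m \<and> v \<in> e i}) = 2 * m"
proof -
  have "(\<Sum>v<n. card {i. i < m \<and> v \<in> e i}) = (\<Sum>v<n. \<Sum>i<m. if v \<in> e i then 1 else 0)"
    by (intro sum.cong refl) (simp add: sum.If_cases Int_def)
  also have "\<dots> = (\<Sum>i<m. \<Sum>v<n. if v \<in> e i then 1 else 0)" by (rule sum.swap)
  also have "\<dots> = (\<Sum>i<m. card (e i))"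
  proof (intro sum.cong refl)
    fix i
    have "{..<n} \<inter> e i = e i" using assms[of i] by (auto simp: complete_edges_def)
    then show "(\<Sum>v<n. if v \<in> e i then 1 else 0) = card (e i)"
      by (simp add: sum.If_cases)
  qed
  also have "\<dots> = 2 * m" by (simp add: card_complete_edge[OF assms])
  finally show ?thesis .
qed

definition good_vertices :: "nat \<Rightarrow> nat \<Rightarrow> nat \<Rightarrow> nat \<Rightarrow> (nat \<Rightarrow> nat set) \<Rightarrow> nat set" where
  "good_vertices n k m m' e =
     {v. v < n \<and> card {i. i < m \<and> v \<in> e i} < k \<and> (\<forall>i. i < m \<longrightarrow> v \<in> e i \<longrightarrow> i < m')}"

text \<open>
  By double counting, at most \<open>2 m / k\<close> vertices reach degree \<open>k\<close>, and the late edges cover at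
  most two vertices each. The inequality is multiplied by \<open>k\<close> to stay within the naturals.
\<close>

lemma card_good_vertices:
  assumes edges: "\<And>i. e i \<in> complete_edges n"
  shows "k * n \<le> k * card (good_vertices n k m m' e) + 2 * m + 2 * k * (m - m')"
proof -
  define H where "H = {v. v < n \<and> k \<le> card {i. i < m \<and> v \<in> e i}}"
  define L where "L = (\<Union>i\<in>{m'..<m}. e i)"
  let ?G = "good_vertices n k m m' e"
  have "k * card H = (\<Sum>v\<in>H. k)" by simp
  also have "\<dots> \<le> (\<Sum>v\<in>H. card {i. i < m \<and> v \<in> e i})" by (rule sum_mono) (simp add: H_def)
  also have "\<dots> \<le> (\<Sum>v<n. card {i. i < m \<and> v \<in> e i})" by (rule sum_mono2) (auto simp: H_def)
  also have "\<dots> = 2 * m" using edges by (rule sum_card_attempts_at)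
  finally have H: "k * card H \<le> 2 * m" .
  have "card L \<le> (\<Sum>i\<in>{m'..<m}. card (e i))" unfolding L_def by (rule card_UN_le) simp
  also have "\<dots> = 2 * (m - m')" by (simp add: card_complete_edge[OF edges])
  finally have L: "card L \<le> 2 * (m - m')" .
  have "finite L" using edges finite_complete_edge by (auto simp: L_def)
  moreover have "{..<n} \<subseteq> ?G \<union> H \<union> L"
    unfolding good_vertices_def H_def L_def by (auto simp: not_less)
  moreover have "finite ?G" "finite H" by (auto simp: good_vertices_def H_def)
  ultimately have "card {..<n} \<le> card (?G \<union> H \<union> L)" by (intro card_mono) auto
  also have "\<dots> \<le> card ?G + card H + card L"
    using card_Un_le[of "?G \<union> H" L] card_Un_le[of ?G H] by linarith
  finally have "k * n \<le> k * (card ?G + card H + card L)" by (intro mult_le_mono2) simp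
  then show ?thesis using H mult_le_mono2[OF L, of k] by (simp add: algebra_simps)
qed

section \<open>Stars and their colour classes\<close>

definition star :: "nat \<Rightarrow> nat \<Rightarrow> nat set set" where
  "star n v = {e \<in> complete_edges n. v \<in> e}"

text \<open>
  For an edge \<open>e\<close> at \<open>v\<close> the sum over the singleton \<open>e - {v}\<close> is the other endpoint of \<open>e\<close>.
  Colouring by residues makes the classes almost equally large.
\<close>

definition colour :: "nat \<Rightarrow> nat \<Rightarrow> nat set \<Rightarrow> nat" where
  "colour q v e = \<Sum>(e - {v}) mod q"

definition reserve :: "nat \<Rightarrow> nat \<Rightarrow> nat \<Rightarrow> nat set \<Rightarrow> nat set set" where
  "reserve n q v J = {e \<in> star n v. colour q v e \<in> J}"

lemma star_subset: "star n v \<subseteq> complete_edges n"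
  by (auto simp: star_def)

lemma finite_star: "finite (star n v)"
  using star_subset finite_complete_edges finite_subset by blast

lemma starE:
  assumes "e \<in> star n v"
  obtains u where "u < n" "u \<noteq> v" "e = {u, v}"
proof -
  from assms have "v \<in> e" "card e = 2" "e \<subseteq> {..<n}" by (auto simp: star_def complete_edges_def)
  then obtain x y where xy: "e = {x, y}" "x \<noteq> y" by (auto simp: card_2_iff)
  show thesis
  proof (cases "v = x")
    case True
    then show thesis using xy \<open>e \<subseteq> {..<n}\<close> by (intro that[of y]) auto
  next
    case False
    then show thesis using xy \<open>e \<subseteq> {..<n}\<close> \<open>v \<in> e\<close> by (intro that[of x]) auto
  qed
qed

lemma card_star:
  assumes "v < n"
  shows "card (star n v) = n - 1"
proof -
  have "star n v = (\<lambda>u. {u, v}) ` ({..<n} - {v})"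
  proof
    show "star n v \<subseteq> (\<lambda>u. {u, v}) ` ({..<n} - {v})" by (auto elim!: starE)
    show "(\<lambda>u. {u, v}) ` ({..<n} - {v}) \<subseteq> star n v"
      using assms by (auto simp: star_def complete_edges_def)
  qed
  moreover have "inj_on (\<lambda>u. {u, v}) ({..<n} - {v})" by (auto simp: inj_on_def doubleton_eq_iff)
  ultimately show ?thesis using assms by (simp add: card_image)
qed

text \<open>
  An edge at \<open>v\<close> is determined by remainder and quotient of its other endpoint modulo \<open>q\<close>, and
  the quotient takes at most \<open>n div q + 1\<close> values.
\<close>

lemma card_reserve_le:
  assumes "finite J"
  shows "card (reserve n q v J) \<le> card J * (n div q + 1)"
proof -
  let ?f = "\<lambda>e. (colour q v e, \<Sum>(e - {v}) div q)"
  have other: "\<Sum>({u, v} - {v}) = u" if "u \<noteq> v" for u :: nat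
    using that by (simp add: insert_Diff_if)
  have "inj_on ?f (reserve n q v J)"
  proof (rule inj_onI)
    fix e e' assume e: "e \<in> reserve n q v J" and e': "e' \<in> reserve n q v J" and eq: "?f e = ?f e'"
    obtain u u' where u: "u \<noteq> v" "e = {u, v}" and u': "u' \<noteq> v" "e' = {u', v}"
      using e e' by (auto simp: reserve_def elim!: starE)
    have "u mod q = u' mod q" "u div q = u' div q"
      using eq other[OF u(1)] other[OF u'(1)] by (simp_all add: colour_def u(2) u'(2))
    then have "u = u'" by (metis div_mult_mod_eq)
    then show "e = e'" by (simp add: u(2) u'(2))
  qed
  moreover have "?f ` reserve n q v J \<subseteq> J \<times> {..n div q}"
  proof
    fix p assume "p \<in> ?f ` reserve n q v J"
    then obtain e where e: "e \<in> reserve n q v J" "p = ?f e" by auto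
    then obtain u where u: "u < n" "u \<noteq> v" "e = {u, v}" by (auto simp: reserve_def elim!: starE)
    have "\<Sum>(e - {v}) div q \<le> n div q"
      using other[OF u(2)] u by (auto intro!: div_le_mono)
    then show "p \<in> J \<times> {..n div q}" using e by (simp add: reserve_def)
  qed
  ultimately have "card (reserve n q v J) \<le> card (J \<times> {..n div q})"
    using assms by (intro card_inj_on_le) auto
  then show ?thesis by (simp add: card_cartesian_product)
qed

section \<open>The strategy with a hidden star\<close>

text \<open>
  The reserve lies inside the star, so the two priorities are nested and hence compatible. Which
  edges are taken within one priority level is irrelevant, so any choice will do.
\<close>

definition star_strategy :: "nat \<Rightarrow> nat \<Rightarrow> nat \<Rightarrow> nat \<times> nat set \<Rightarrow> nat set breaker" where
  "star_strategy n b q = (\<lambda>(v, J). SOME \<tau>. breaker_strategy (complete_edges n) b \<tau> \<and>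
     prioritizing (complete_edges n) (star n v - reserve n q v J) \<tau> \<and>
     prioritizing (complete_edges n) (star n v) \<tau>)"

lemma star_strategy:
  "breaker_strategy (complete_edges n) b (star_strategy n b q (v, J))"
  "prioritizing (complete_edges n) (star n v - reserve n q v J) (star_strategy n b q (v, J))"
  "prioritizing (complete_edges n) (star n v) (star_strategy n b q (v, J))"
  using someI_ex[OF ex_prioritizing_breaker[OF finite_complete_edges,
      of "star n v - reserve n q v J" "star n v" n b]]
  unfolding star_strategy_def by auto

text \<open>
  A correct guess wins. If \<open>v\<close> is neglected and \<open>J\<close> consists of the colours that the ideal
  attempts have at \<open>v\<close>, then \<open>J\<close> has at most \<open>k - 1\<close> elements, so the reserve is small, and
  Maker never gets more of the star than the ideal attempts at \<open>v\<close>. Her degree at \<open>v\<close> stays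
  below \<open>k\<close> and thus below every larger \<open>k'\<close>.
\<close>

lemma star_strategy_wins:
  fixes \<sigma> :: "nat set maker"
  assumes good: "v \<in> good_vertices n k (a * T) (a * T') (ideal_attempt \<sigma>)"
    and J: "J = colour q v ` ideal_attempt \<sigma> ` {i. i < a * T \<and> v \<in> ideal_attempt \<sigma> i}"
    and stock: "b * T' + (k - 1) * (n div q + 1) + 1 \<le> n"
    and exhaust: "n \<le> b * T"
    and "k \<le> k'"
  shows "\<not> maker_wins (mindegree_sets n k') a \<sigma> (star_strategy n b q (v, J))"
proof
  let ?A = "{i. i < a * T \<and> v \<in> ideal_attempt \<sigma> i}"
  let ?\<tau> = "star_strategy n b q (v, J)"
  have v: "v < n" and few: "card ?A < k"
    and early: "\<And>i. i < a * T \<Longrightarrow> v \<in> ideal_attempt \<sigma> i \<Longrightarrow> i < a * T'"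
    using good by (auto simp: good_vertices_def)
  have cardJ: "card J \<le> k - 1"
  proof -
    have "card J \<le> card ?A" unfolding J image_image by (rule card_image_le) simp
    then show ?thesis using few by linarith
  qed
  have "finite J" by (simp add: J)
  then have "card (reserve n q v J) \<le> (k - 1) * (n div q + 1)"
    using card_reserve_le mult_le_mono1[OF cardJ] le_trans by blast
  moreover have "card (star n v) - card (reserve n q v J) \<le> card (star n v - reserve n q v J)"
    by (rule diff_card_le_card_Diff) (auto simp: reserve_def finite_star)
  ultimately have stock': "b * T' \<le> card (star n v - reserve n q v J)"
    using stock card_star[OF v] by linarith
  interpret hidden_target "complete_edges n" "star n v" "reserve n q v J" a b T T' \<sigma> ?\<tau>
  proof
    show "reserve n q v J \<subseteq> star n v" by (auto simp: reserve_def)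
    show "i < a * T' \<and> ideal_attempt \<sigma> i \<in> reserve n q v J"
      if "i < a * T" "ideal_attempt \<sigma> i \<in> star n v" for i
    proof -
      have "v \<in> ideal_attempt \<sigma> i" using that(2) by (simp add: star_def)
      then show ?thesis using that early unfolding reserve_def J by blast
    qed
    show "card (star n v) < b * T" using card_star[OF v] exhaust v by linarith
  qed (use finite_complete_edges star_subset star_strategy stock' in auto)
  assume "maker_wins (mindegree_sets n k') a \<sigma> ?\<tau>"
  then obtain t F where F: "F \<in> mindegree_sets n k'" "F \<subseteq> maker_edges (play a \<sigma> ?\<tau> t)"
    unfolding maker_wins_def by blast
  have "k' \<le> vertex_degree F v"
    using F(1) v by (auto simp: mindegree_sets_def min_degree_def)
  also have "{e \<in> F. v \<in> e} \<subseteq> ideal_attempt \<sigma> ` ?A"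
    using F maker_edges_play_subset[of t] by (auto simp: mindegree_sets_def star_def)
  then have "vertex_degree F v \<le> card (ideal_attempt \<sigma> ` ?A)"
    unfolding vertex_degree_def by (intro card_mono) auto
  also have "\<dots> \<le> card ?A" by (rule card_image_le) simp
  finally show False using few \<open>k \<le> k'\<close> by linarith
qed

section \<open>Randomization\<close>

text \<open>
  Maker's randomness is independent of PhantomBreaker's, so a bound against each of her
  deterministic strategies carries over to their mixture.
\<close>

lemma breaker_win_prob_ge:
  assumes "\<And>\<sigma>. \<sigma> \<in> set_pmf M \<Longrightarrow> c \<le> measure_pmf.prob B {\<tau>. \<not> maker_wins W a \<sigma> \<tau>}"
  shows "c \<le> breaker_win_prob W a M B"
proof -
  let ?E = "{(\<sigma>, \<tau>). \<not> maker_wins W a \<sigma> \<tau>}"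
  have "ennreal c = (\<integral>\<^sup>+ \<sigma>. ennreal c \<partial>M)" by simp
  also have "\<dots> \<le> (\<integral>\<^sup>+ \<sigma>. emeasure B {\<tau>. \<not> maker_wins W a \<sigma> \<tau>} \<partial>M)"
    using assms
    by (intro nn_integral_mono_AE) (auto simp: AE_measure_pmf_iff measure_pmf.emeasure_eq_measure)
  also have "\<dots> = emeasure (pair_pmf M B) ?E"
  proof -
    have "emeasure (pair_pmf M B) ?E = (\<integral>\<^sup>+ x. indicator ?E x \<partial>pair_pmf M B)" by simp
    also have "\<dots> = (\<integral>\<^sup>+ \<sigma>. \<integral>\<^sup>+ \<tau>. indicator {\<tau>. \<not> maker_wins W a \<sigma> \<tau>} \<tau> \<partial>B \<partial>M)"
      unfolding nn_integral_pair_pmf' by (simp add: indicator_def)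
    finally show ?thesis by simp
  qed
  finally show ?thesis
    by (simp add: breaker_win_prob_def measure_pmf.emeasure_eq_measure)
qed

definition random_star_strategy :: "nat \<Rightarrow> nat \<Rightarrow> nat \<Rightarrow> nat set breaker pmf" where
  "random_star_strategy n b q = map_pmf (star_strategy n b q) (pmf_of_set ({..<n} \<times> Pow {..<q}))"

lemma randomized_breaker_random_star_strategy:
  "0 < n \<Longrightarrow> randomized_breaker (complete_edges n) b (random_star_strategy n b q)"
  using star_strategy(1) by (auto simp: randomized_breaker_def random_star_strategy_def)

text \<open>
  The winning set of colours \<open>J v\<close> depends on Maker's strategy, which is why it is guessed
  among all \<open>2 ^ q\<close> sets.
\<close>

lemma prob_random_star_strategy_ge:
  assumes "0 < n"
    and wins: "\<And>v. v \<in> G \<Longrightarrow> v < n \<and> J v \<subseteq> {..<q} \<and> star_strategy n b q (v, J v) \<in> E"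
  shows "real (card G) / (real n * 2 ^ q) \<le> measure_pmf.prob (random_star_strategy n b q) E"
proof -
  let ?\<Omega> = "{..<n} \<times> Pow {..<q}"
  have \<Omega>: "finite ?\<Omega>" "?\<Omega> \<noteq> {}" using assms(1) by auto
  have "card G = card ((\<lambda>v. (v, J v)) ` G)" by (simp add: card_image inj_on_def)
  also have "\<dots> \<le> card (?\<Omega> \<inter> star_strategy n b q -` E)"
    using wins by (intro card_mono) auto
  finally have "real (card G) / real (card ?\<Omega>)
      \<le> real (card (?\<Omega> \<inter> star_strategy n b q -` E)) / real (card ?\<Omega>)"
    by (intro divide_right_mono) auto
  also have "\<dots> = measure_pmf.prob (random_star_strategy n b q) E"
    using measure_pmf_of_set[OF \<Omega>(2,1)] by (simp add: random_star_strategy_def)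
  finally show ?thesis by (simp add: card_cartesian_product card_Pow)
qed

section \<open>Numbers of rounds\<close>

text \<open>
  With \<open>D = 2 a + 1\<close>, the last \<open>L = n div (8 a b D)\<close> rounds form the final phase. The choice of
  \<open>L\<close> is a compromise. The \<open>a L\<close> late attempts may spoil only part of the \<open>n / (b k)\<close> vertices
  that \<open>2 a < b k\<close> provides: the third inequality, together with \<open>card_good_vertices\<close>, leaves
  at least \<open>n / (2 b k)\<close> good vertices. On the other hand the \<open>b L\<close> claims of the final phase, about
  \<open>n / (8 a D)\<close>, must exceed the reserve. This determines \<open>q\<close>: the reserve has about
  \<open>2 a n / q = n / (16 a D)\<close> edges at most, half as many. The other half, \<open>n / (16 a D)\<close>,
  absorbs the rounding errors if \<open>n\<close> is large.
\<close>

lemma round_counts: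
  fixes a b k n :: nat
  assumes pos: "0 < a" "0 < b" and k: "k \<le> 2 * a + 1" and gap: "2 * a < b * k"
    and n: "16 * a * (2 * a + 1) * (2 * a + 2 * b + 1) \<le> n"
  defines "q \<equiv> 32 * a\<^sup>2 * (2 * a + 1)"
    and "T \<equiv> n div b + 1"
    and "T' \<equiv> n div b + 1 - n div (8 * a * b * (2 * a + 1))"
  shows "n \<le> b * T"
    and "b * T' + (k - 1) * (n div q + 1) + 1 \<le> n"
    and "2 * b * (2 * a * T + 2 * k * (a * T - a * T')) + n \<le> 2 * b * (k * n)"
proof -
  define D where "D = 2 * a + 1"
  define L where "L = n div (8 * a * b * D)"
  have "0 < D" by (simp add: D_def)
  have T: "n \<le> b * T" "b * T \<le> n + b"
    using dividend_less_times_div[OF pos(2), of n] by (simp_all add: T_def)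
  show "n \<le> b * T" by (rule T(1))
  have "n div (8 * a * b * D) \<le> n div b"
    using pos \<open>0 < D\<close> by (intro div_le_mono2) auto
  then have LT: "T' + L = T" by (simp add: T_def T'_def L_def D_def)
  have n': "16 * a * D * (D + 2 * b) \<le> n" using n by (simp add: D_def algebra_simps)

  have "b * T' + b * L = b * T" using LT by (metis add_mult_distrib2)
  (* Multiplication by 16 a D turns the sizes of the reserve and of the final phase into
     multiples of n, up to rounding. *)
  moreover have "(k - 1) * (n div q + 1) + b + 1 \<le> b * L"
  proof -
    let ?P = "16 * a * D"
    have "(k - 1) * (n div q + 1) \<le> 2 * a * (n div q + 1)"
      using k by (intro mult_le_mono1) simp
    then have "?P * ((k - 1) * (n div q + 1)) \<le> ?P * (2 * a * (n div q + 1))"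
      by (rule mult_le_mono2)
    also have "\<dots> = q * (n div q) + ?P * (2 * a)"
      by (simp add: q_def D_def power2_eq_square algebra_simps)
    also have "\<dots> \<le> n + ?P * (2 * a)" by simp
    finally have "?P * ((k - 1) * (n div q + 1)) \<le> n + ?P * (2 * a)" .
    moreover have "n < 8 * a * b * D + 8 * a * b * D * L"
      unfolding L_def using pos \<open>0 < D\<close> by (intro dividend_less_times_div) simp
    then have "2 * n \<le> ?P * (b * L) + ?P * b" by (simp add: algebra_simps)
    moreover have "?P * D + 2 * (?P * b) \<le> n" using n' by (simp add: algebra_simps)
    moreover have "?P * D = ?P * (2 * a) + ?P" by (simp add: D_def algebra_simps)
    ultimately have "?P * ((k - 1) * (n div q + 1)) + ?P * b + ?P \<le> ?P * (b * L)" by linarith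
    then have "?P * ((k - 1) * (n div q + 1) + b + 1) \<le> ?P * (b * L)"
      by (simp only: add_mult_distrib2 mult_1_right)
    moreover have "0 < ?P" using pos(1) \<open>0 < D\<close> by simp
    ultimately show ?thesis by (metis nat_mult_le_cancel1)
  qed
  ultimately show "b * T' + (k - 1) * (n div q + 1) + 1 \<le> n" using T(2) by linarith

  (* Of the gap 2 b k n - 4 a n >= 2 n, one n is left for the good vertices; the late attempts
     and the rounding of T use at most n / 2 each. *)
  have "a * T - a * T' = a * L" using LT by (metis add_diff_cancel_left' add_mult_distrib2)
  moreover have "2 * b * (2 * a * T + 2 * k * (a * L)) + n \<le> 2 * b * (k * n)"
  proof -
    have "4 * a * (b * T) \<le> 4 * a * (n + b)" using T(2) by (rule mult_le_mono2)
    then have "4 * a * (b * T) \<le> 4 * (a * n) + 4 * (a * b)" by (simp add: algebra_simps)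
    moreover have "2 * (4 * a * b * k * L) \<le> n"
    proof -
      have "2 * (4 * a * b * k * L) = 8 * a * b * L * k" by simp
      also have "\<dots> \<le> 8 * a * b * L * D" using k by (intro mult_le_mono2) (simp add: D_def)
      also have "\<dots> = 8 * a * b * D * (n div (8 * a * b * D))" by (simp add: L_def)
      also have "\<dots> \<le> n" by simp
      finally show ?thesis .
    qed
    moreover have "8 * (a * b) \<le> n"
    proof -
      have "8 * (a * b) * 1 \<le> 8 * (a * b) * (4 * D)"
        using \<open>0 < D\<close> by (intro mult_le_mono2) simp
      also have "\<dots> \<le> 16 * a * D * (D + 2 * b)" by (simp add: algebra_simps)
      finally have "8 * (a * b) * 1 \<le> n" using n' by (rule le_trans)
      then show ?thesis by simp
    qed
    moreover have "(2 * a + 1) * n \<le> b * k * n" using gap by (intro mult_le_mono1) simp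
    then have "2 * (2 * a * n) + 2 * n \<le> 2 * (b * k * n)" by simp
    ultimately have "4 * a * (b * T) + 4 * a * b * k * L + n \<le> 2 * (b * k * n)" by linarith
    then show ?thesis by (simp add: algebra_simps)
  qed
  ultimately show "2 * b * (2 * a * T + 2 * k * (a * T - a * T')) + n \<le> 2 * b * (k * n)" by simp
qed

section \<open>PhantomBreaker wins with positive probability\<close>

theorem theorem2:
  fixes a b :: nat
  assumes "a > 0" and "b > 0"
  shows "\<exists>c::real. c > 0 \<and>
    (\<forall>k::nat. k > 0 \<longrightarrow> real b > 2 * real a / real k \<longrightarrow>
      (\<exists>n0::nat. \<forall>n\<ge>n0.
        \<exists>B. randomized_breaker (complete_edges n) b B \<and>
          (\<forall>M. randomized_maker (complete_edges n) M \<longrightarrow>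
            breaker_win_prob (mindegree_sets n k) a M B \<ge> c)))"
proof -
  define q where "q = 32 * a\<^sup>2 * (2 * a + 1)"
  define n0 where "n0 = 16 * a * (2 * a + 1) * (2 * a + 2 * b + 1)"
  define N where "N = 2 * b * (2 * a + 1)"
  define c where "c = 1 / (real N * 2 ^ q)"
  have q: "0 < q" using assms(1) by (simp add: q_def)
  have N: "0 < N" using assms(2) by (simp add: N_def)
  have "breaker_win_prob (mindegree_sets n k) a M (random_star_strategy n b q) \<ge> c"
    if k: "k > 0" "real b > 2 * real a / real k" and n: "n \<ge> n0"
      and M: "randomized_maker (complete_edges n) M" for k n M
  proof (rule breaker_win_prob_ge)
    (* The cap 2 a + 1 makes q and c independent of k. *)
    define k0 where "k0 = min k (2 * a + 1)"
    define T where "T = n div b + 1"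
    define T' where "T' = n div b + 1 - n div (8 * a * b * (2 * a + 1))"
    have "real (2 * a) < real (b * k)" using k by (simp add: field_simps)
    then have "2 * a < b * k" by (simp only: of_nat_less_iff)
    moreover have "2 * a + 1 \<le> b * (2 * a + 1)"
      using assms(2) mult_le_mono1[of 1 b "2 * a + 1"] by simp
    ultimately have gap: "2 * a < b * k0" by (auto simp: k0_def min_def)
    have k0: "k0 \<le> 2 * a + 1" "k0 \<le> k" by (auto simp: k0_def)
    have "0 < n0" using assms by (simp add: n0_def)
    then have npos: "0 < n" using n by linarith
    note counts = round_counts[OF assms k0(1) gap n[unfolded n0_def],
        folded T_def T'_def q_def]
    fix \<sigma> assume "\<sigma> \<in> set_pmf M"
    then have \<sigma>: "maker_strategy (complete_edges n) \<sigma>"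
      using M by (auto simp: randomized_maker_def)
    define G where "G = good_vertices n k0 (a * T) (a * T') (ideal_attempt \<sigma>)"
    define J where "J v = colour q v ` ideal_attempt \<sigma> ` {i. i < a * T \<and> v \<in> ideal_attempt \<sigma> i}" for v
    have wins: "v < n \<and> J v \<subseteq> {..<q} \<and>
        star_strategy n b q (v, J v) \<in> {\<tau>. \<not> maker_wins (mindegree_sets n k) a \<sigma> \<tau>}"
      if "v \<in> G" for v
      using that star_strategy_wins[OF _ J_def counts(2,1) k0(2), of v] q
      by (auto simp: G_def J_def colour_def good_vertices_def)
    have "n \<le> N * card G"
    proof -
      have "k0 * n \<le> k0 * card G + 2 * (a * T) + 2 * k0 * (a * T - a * T')"
        unfolding G_def using \<sigma>
        by (intro card_good_vertices) (simp add: maker_strategy_def ideal_attempt_def)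
      then have "2 * b * (k0 * n) \<le> 2 * b * (k0 * card G + 2 * (a * T) + 2 * k0 * (a * T - a * T'))"
        by (rule mult_le_mono2)
      then have "n \<le> 2 * b * (k0 * card G)" using counts(3) by (simp add: algebra_simps)
      also have "\<dots> \<le> 2 * b * ((2 * a + 1) * card G)"
        using k0(1) by (intro mult_le_mono2 mult_le_mono1)
      finally show ?thesis by (simp add: N_def algebra_simps)
    qed
    then have "real n \<le> real N * real (card G)"
      by (simp only: of_nat_le_iff flip: of_nat_mult)
    then have "c \<le> real (card G) / (real n * 2 ^ q)"
      using npos N by (simp add: c_def field_simps)
    also have "\<dots> \<le> measure_pmf.prob (random_star_strategy n b q)
        {\<tau>. \<not> maker_wins (mindegree_sets n k) a \<sigma> \<tau>}"
      using npos wins by (rule prob_random_star_strategy_ge)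
    finally show "c \<le> measure_pmf.prob (random_star_strategy n b q)
        {\<tau>. \<not> maker_wins (mindegree_sets n k) a \<sigma> \<tau>}" .
  qed
  moreover have "randomized_breaker (complete_edges n) b (random_star_strategy n b q)"
    if "n \<ge> n0" for n
    using that assms by (intro randomized_breaker_random_star_strategy) (simp add: n0_def)
  moreover have "c > 0" using N by (simp add: c_def)
  ultimately show ?thesis by blast
qed

end
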